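(* Let $k$ be a positive integer and $s>0$. There is a bijection between the set $\mathcal{FB}_{-1}(s,k)$ and the set $\mathcal{B}^o(s,k)$.
   Context: A free ballot $(s,k)$-path of height $n$ is a lattice path from $(0,0)$ to $(s,n)$ using up steps $(k/2,1)$, down steps $(k/2,-1)$ and horizontal steps $(\ell,0)$ with $\ell$ an integer, $1\le\ell<k$ (it may go below the $x$-axis); $\mathcal{FB}_n(s,k)$ denotes the set of these. A ballot $(s,k)$-path of height $n$ is such a path that never lies below the $x$-axis. $\mathcal{B}^o(s,k)$ is the set of ballot $(s,k)$-paths of odd height (the height being any odd $n\ge1$). *)

theory Defs
  imports Complex_Main "HOL-Library.Product_Plus"
begin

text \<open>
  A path is the list of its steps, each step a displacement vector; it starts at the origin.
  Two paths are equal iff they have the same step sequence, so that, for instance, two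
  consecutive steps (1, 0) differ from the single step (2, 0).
  First coordinates are real since k / 2 need not be an integer; for the same reason
  the endpoint abscissa s is real (for odd k and odd height it is a half-integer).
\<close>

type_synonym step = "real \<times> int"

definition steps :: "nat \<Rightarrow> step set" where
  "steps k = {(real k / 2, 1), (real k / 2, -1)} \<union> {(real l, 0) | l. 1 \<le> l \<and> l < k}"

definition free_ballot_paths :: "int \<Rightarrow> real \<Rightarrow> nat \<Rightarrow> step list set" where
  "free_ballot_paths n s k = {p. set p \<subseteq> steps k \<and> sum_list p = (s, n)}"

text \<open>
  A path lies weakly above the x-axis iff all of its vertices, i.e. the partial sums of
  its steps, do.
\<close>

definition ballot_paths :: "int \<Rightarrow> real \<Rightarrow> nat \<Rightarrow> step list set" where
  "ballot_paths n s k =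
     {p \<in> free_ballot_paths n s k. \<forall>i \<le> length p. snd (sum_list (take i p)) \<ge> 0}"

definition odd_ballot_paths :: "real \<Rightarrow> nat \<Rightarrow> step list set" where
  "odd_ballot_paths s k = (\<Union>n \<in> {n. n \<ge> 1 \<and> odd n}. ballot_paths n s k)"

end

theory Submission
  imports Defs
begin

text \<open>
  Turn upwards every down step of a free path that reaches a new minimum. A path ending at
  height \<open>e\<close> with minimum \<open>-m\<close> becomes a path that stays weakly above the axis and ends at
  height \<open>e + 2 m\<close>; the turned steps are now the last up steps to the heights \<open>1, \<dots>, m\<close>.
  Hence free paths correspond to pairs of a ballot path of height \<open>n\<close> and an integer \<open>m\<close>
  with \<open>0 \<le> m \<le> n\<close>. For \<open>e = -1\<close> the height is \<open>n = 2 m - 1\<close>, which runs through the odd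
  positive integers and determines \<open>m\<close>.
\<close>

text \<open>
  The functions below take paths with the last step first, since the inverse map
  has to read a path from its end.
\<close>

definition height :: "step list \<Rightarrow> int" where
  "height p = snd (sum_list p)"

definition flip :: "step \<Rightarrow> step" where
  "flip x = (fst x, - snd x)"

fun depth :: "step list \<Rightarrow> int" where
  "depth [] = 0"
| "depth (x # p) = max (depth p) (- height (x # p))"

fun nonneg :: "step list \<Rightarrow> bool" where
  "nonneg [] \<longleftrightarrow> True"
| "nonneg (x # p) \<longleftrightarrow> nonneg p \<and> 0 \<le> height (x # p)"

fun raise :: "step list \<Rightarrow> step list" where
  "raise [] = []"
| "raise (x # p) = (if depth p < depth (x # p) then flip x else x) # raise p"

text \<open>Scanning starts at the last step, so the first up step met at height \<open>m\<close> is
  the last one to that height. Under \<open>nonneg\<close> nothing is turned once \<open>m\<close>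
  is 0, since up steps then end at height at least 1.\<close>

fun lower :: "int \<Rightarrow> step list \<Rightarrow> step list" where
  "lower m [] = []"
| "lower m (x # q) =
     (if snd x = 1 \<and> height (x # q) = m then flip x # lower (m - 1) q else x # lower m q)"

lemma height_simps [simp]:
  "height [] = 0" "height (x # p) = snd x + height p" "height (rev p) = height p"
  by (simp_all add: height_def sum_list_rev)

lemma flip_simps [simp]: "fst (flip x) = fst x" "snd (flip x) = - snd x" "flip (flip x) = x"
  by (simp_all add: flip_def)

lemma flip_in_steps [simp]: "flip x \<in> steps k \<longleftrightarrow> x \<in> steps k"
  by (cases x) (auto simp: steps_def flip_def)

lemma snd_step_cases:
  assumes "x \<in> steps k"
  obtains "snd x = 1" | "snd x = 0" | "snd x = -1"
  using assms by (auto simp: steps_def)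

lemma depth_bounds: "0 \<le> depth p" "- height p \<le> depth p"
  by (induction p) auto

lemma steps_raise: "set p \<subseteq> steps k \<Longrightarrow> set (raise p) \<subseteq> steps k"
  by (induction p) auto

lemma fst_sum_raise: "fst (sum_list (raise p)) = fst (sum_list p)"
  by (induction p) auto

text \<open>Steps change the height by at most 1, so a new minimum deepens \<open>depth\<close> by
  exactly 1, and turning its down step adds 2 to the height.\<close>

lemma height_raise: "set p \<subseteq> steps k \<Longrightarrow> height (raise p) = height p + 2 * depth p"
proof (induction p)
  case (Cons x p)
  then have "x \<in> steps k" "height (raise p) = height p + 2 * depth p" by auto
  then show ?case
    using depth_bounds[of p] by (cases rule: snd_step_cases) (auto simp: max_def)
qed simp

lemma nonneg_raise:
  assumes "set p \<subseteq> steps k"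
  shows "nonneg (raise p)"
  using assms
proof (induction p)
  case (Cons x p)
  have "height (raise (x # p)) = height (x # p) + 2 * depth (x # p)"
    using Cons.prems by (rule height_raise)
  then have "0 \<le> height (raise (x # p))"
    using depth_bounds[of "x # p"] by linarith
  then show ?case using Cons by simp
qed simp

text \<open>A turned step ends, after raising, exactly at the current \<open>depth\<close>. An
  original up step ends strictly above it, so \<open>lower\<close> picks out just the turned
  steps.\<close>

lemma lower_raise: "set p \<subseteq> steps k \<Longrightarrow> lower (depth p) (raise p) = p"
proof (induction p)
  case (Cons x p)
  then have "x \<in> steps k" "height (raise p) = height p + 2 * depth p"
    "lower (depth p) (raise p) = p"
    by (auto simp: height_raise)
  \<comment> \<open>A down step reaches a new minimum iff the path stood at its minimum before
    it.\<close>
  moreover have "depth p < 1 - height p \<longleftrightarrow> depth p = - height p"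
    using depth_bounds[of p] by linarith
  ultimately show ?case
    using depth_bounds[of p] by (cases rule: snd_step_cases) (auto simp: max_def)
qed simp

lemma steps_lower: "set q \<subseteq> steps k \<Longrightarrow> set (lower m q) \<subseteq> steps k"
  by (induction q arbitrary: m) auto

lemma fst_sum_lower: "fst (sum_list (lower m q)) = fst (sum_list q)"
  by (induction q arbitrary: m) auto

text \<open>The three claims need a joint induction: \<open>raise\<close> consults
  \<open>depth\<close>, which consults \<open>height\<close>. Before a turned step the lowered path
  stands at its minimum \<open>-(m - 1)\<close>; after any other step its height is still at least
  \<open>-m\<close>.\<close>

lemma raise_lower_aux:
  assumes "set q \<subseteq> steps k" "nonneg q" "0 \<le> m" "m \<le> height q"
  shows "height (lower m q) = height q - 2 * m \<and> depth (lower m q) = m \<and> raise (lower m q) = q"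
  using assms
proof (induction q arbitrary: m)
  case (Cons x q)
  then have x: "x \<in> steps k" and q: "set q \<subseteq> steps k" "nonneg q" "0 \<le> height (x # q)"
    by auto
  have "0 \<le> height q" using q(2) by (cases q) auto
  show ?case
  proof (cases "snd x = 1 \<and> height (x # q) = m")
    case True
    then show ?thesis
      using Cons.IH[of "m - 1"] q \<open>0 \<le> height q\<close> by auto
  next
    case False
    \<comment> \<open>Only an up step ending exactly at \<open>m\<close> could start below
      \<open>m\<close>, and that case is excluded.\<close>
    have "m \<le> height q"
      using x False Cons.prems(4) by (cases rule: snd_step_cases) auto
    then show ?thesis
      using False Cons.IH[of m] q Cons.prems by auto
  qed
qed simp

lemma nonneg_rev_iff: "nonneg (rev p) \<longleftrightarrow> (\<forall>i \<le> length p. 0 \<le> snd (sum_list (take i p)))"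
proof (induction p rule: rev_induct)
  case (snoc x p)
  have "height (x # rev p) = snd (sum_list (p @ [x]))"
    by (simp add: height_def sum_list_rev)
  then show ?case
    using snoc by (auto simp: le_Suc_eq all_conj_distrib)
qed simp

lemma free_ballot_paths_iff:
  "p \<in> free_ballot_paths n s k \<longleftrightarrow>
     set p \<subseteq> steps k \<and> fst (sum_list p) = s \<and> height p = n"
  by (auto simp: free_ballot_paths_def height_def prod_eq_iff)

lemma odd_ballot_paths_iff:
  "q \<in> odd_ballot_paths s k \<longleftrightarrow>
     set q \<subseteq> steps k \<and> fst (sum_list q) = s \<and> nonneg (rev q) \<and> 1 \<le> height q \<and> odd (height q)"
  by (auto simp: odd_ballot_paths_def ballot_paths_def free_ballot_paths_iff nonneg_rev_iff)

theorem theorem2p17: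
  fixes s :: real and k :: nat
  assumes "k > 0" and "s > 0"
  shows "\<exists>f. bij_betw f (free_ballot_paths (-1) s k) (odd_ballot_paths s k)"
proof -
  define f where "f p = rev (raise (rev p))" for p
  define g where "g q = rev (lower ((height q + 1) div 2) (rev q))" for q
  have f: "f p \<in> odd_ballot_paths s k \<and> g (f p) = p" if "p \<in> free_ballot_paths (-1) s k" for p
  proof -
    have p: "set (rev p) \<subseteq> steps k" "fst (sum_list (rev p)) = s" "height (rev p) = -1"
      using that by (auto simp: free_ballot_paths_iff sum_list_rev)
    have h: "height (raise (rev p)) = 2 * depth (rev p) - 1"
      using height_raise[OF p(1)] p(3) by simp
    \<comment> \<open>Ending at -1 forces depth at least 1, so this odd height is at least
      1.\<close>
    then show ?thesis
      using p depth_bounds[of "rev p"] steps_raise[OF p(1)] fst_sum_raise[of "rev p"]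
        nonneg_raise[OF p(1)] lower_raise[OF p(1)]
      by (simp add: odd_ballot_paths_iff f_def g_def sum_list_rev)
  qed
  have g: "g q \<in> free_ballot_paths (-1) s k \<and> f (g q) = q" if "q \<in> odd_ballot_paths s k" for q
  proof -
    define m where "m = (height q + 1) div 2"
    have q: "set (rev q) \<subseteq> steps k" "nonneg (rev q)" "fst (sum_list (rev q)) = s"
      "1 \<le> height q" "odd (height q)"
      using that by (auto simp: odd_ballot_paths_iff sum_list_rev)
    have hm: "height q = 2 * m - 1"
      using q(5) by (auto simp: m_def elim!: oddE)
    \<comment> \<open>Since \<open>2 * m - 1\<close> is at least 1, so is \<open>m\<close>, whence
      \<open>m \<le> 2 * m - 1\<close>.\<close>
    then have "0 \<le> m" "m \<le> height (rev q)"
      using q(4) by auto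
    from raise_lower_aux[OF q(1,2) this] show ?thesis
      using steps_lower[OF q(1), of m] fst_sum_lower[of m "rev q"] q(3) hm
      by (simp add: free_ballot_paths_iff f_def g_def sum_list_rev flip: m_def)
  qed
  have "bij_betw f (free_ballot_paths (-1) s k) (odd_ballot_paths s k)"
    using f g by (intro bij_betw_byWitness[where f' = g]) auto
  then show ?thesis by blast
qed

end
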